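(* Consider unilateral link formation with $n\ge 3$ players, link cost $\alpha>0$ and some adversary. Let $S$ be a cycle through all $n$ players with all edges pointing in the same direction, i.e. for some cyclic ordering $v_1,\dots,v_n$ of the players, $S_{v_iv_{i+1}}=1$ for all $i$ (indices mod $n$) and all other entries of $S$ are $0$. (i) If $\alpha\le 1$, then $S$ is a maximal Nash equilibrium. (ii) If $\alpha\le \frac12\left\lfloor\frac{n-1}{2}\right\rfloor$ and disconnection cost is anonymous, then $S$ is a maximal Nash equilibrium.
   Context: Players are $V=\{1,\dots,n\}$ ($n\ge 3$), link cost is $\alpha>0$. A strategy profile is a matrix $S\in\{0,1\}^{n\times n}$ with $S_{vv}=0$; for $v\ne w$, $S_{vw}=1$ means that player $v$ requests the edge $\{v,w\}$. Unilateral link formation: the final graph is the simple undirected graph $G(S)=(V,E(S))$ with $E(S)=\{\{v,w\}: S_{vw}=1 \text{ or } S_{wv}=1\}$. An adversary assigns to each graph $G=(V,E)$ a probability measure $\Pr_G$ on $E$. For a connected graph $G$, $e\in E$, $v\in V$, the relevance $\mathrm{rel}_G(e,v)$ is the number of vertices that, starting at $v$, can only be reached via $e$ (so it is $0$ iff $e$ is not a bridge). The disconnection cost of $v$ is $I_v(G)=\sum_{e\in E}\mathrm{rel}_G(e,v)\Pr_G(\{e\})$ if $G$ is connected and $I_v(G)=\infty$ otherwise. Disconnection cost is anonymous if for every final graph $G$, every graph automorphism $\phi$ of $G$ and every $v\in V$: $I_v(G)=I_{\phi(v)}(G)$. Individual cost: $C_v(S)=\alpha\sum_{w}S_{vw}+I_v(G(S))$.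 $S$ is a Nash equilibrium if no player $v$ can strictly decrease $C_v$ by changing her own row $S_v$ (arbitrarily) while the other rows stay fixed. A Nash equilibrium $S$ is maximal if for every player $v$ and all distinct $w_1,\dots,w_k$ ($k\ge1$, $w_i\neq v$) with $\{v,w_i\}\notin E(S)$ for all $i$, setting the entries $S_{vw_1},\dots,S_{vw_k}$ to $1$ strictly increases $C_v$. *)

theory Defs
  imports "HOL-Probability.Probability_Mass_Function"
begin

definition players :: "nat \<Rightarrow> nat set" where
  "players n = {1..n}"

text \<open>A graph on the vertex set \<open>players n\<close> is represented by its edge set, an edge being a
  two-element set of vertices.\<close>

definition simple_graph :: "nat \<Rightarrow> nat set set \<Rightarrow> bool" where
  "simple_graph n E \<longleftrightarrow> E \<subseteq> {{u, w} |u w. u \<in> players n \<and> w \<in> players n \<and> u \<noteq> w}"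

definition walk_edges :: "nat list \<Rightarrow> nat set list" where
  "walk_edges xs = map2 (\<lambda>x y. {x, y}) xs (tl xs)"

text \<open>Walks are given by their nonempty vertex list; \<open>[v]\<close> is the walk of length zero at \<open>v\<close>.\<close>

definition walk :: "nat \<Rightarrow> nat set set \<Rightarrow> nat \<Rightarrow> nat list \<Rightarrow> nat \<Rightarrow> bool" where
  "walk n E u xs w \<longleftrightarrow>
     xs \<noteq> [] \<and> hd xs = u \<and> last xs = w \<and> set xs \<subseteq> players n \<and> set (walk_edges xs) \<subseteq> E"

definition graph_connected :: "nat \<Rightarrow> nat set set \<Rightarrow> bool" where
  "graph_connected n E \<longleftrightarrow> (\<forall>u \<in> players n. \<forall>w \<in> players n. \<exists>xs. walk n E u xs w)"

definition graph_automorphism :: "nat \<Rightarrow> nat set set \<Rightarrow> (nat \<Rightarrow> nat) \<Rightarrow> bool" where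
  "graph_automorphism n E \<phi> \<longleftrightarrow>
     bij_betw \<phi> (players n) (players n) \<and>
     (\<forall>u \<in> players n. \<forall>w \<in> players n. {u, w} \<in> E \<longleftrightarrow> {\<phi> u, \<phi> w} \<in> E)"

definition relevance :: "nat \<Rightarrow> nat set set \<Rightarrow> nat set \<Rightarrow> nat \<Rightarrow> nat" where
  "relevance n E e v = card {w \<in> players n. \<forall>xs. walk n E v xs w \<longrightarrow> e \<in> set (walk_edges xs)}"

text \<open>The edgeless graph is exempt, since there is no probability measure on the empty set. For
  \<open>n \<ge> 2\<close> it is disconnected, so that its disconnection cost does not involve the adversary.\<close>

definition adversary :: "nat \<Rightarrow> (nat set set \<Rightarrow> nat set pmf) \<Rightarrow> bool" where
  "adversary n Pr \<longleftrightarrow> (\<forall>E. simple_graph n E \<and> E \<noteq> {} \<longrightarrow> set_pmf (Pr E) \<subseteq> E)"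

definition disconnection_cost ::
  "nat \<Rightarrow> (nat set set \<Rightarrow> nat set pmf) \<Rightarrow> nat set set \<Rightarrow> nat \<Rightarrow> ereal" where
  "disconnection_cost n Pr E v =
     (if graph_connected n E
      then ereal (\<Sum>e\<in>E. real (relevance n E e v) * measure_pmf.prob (Pr E) {e})
      else \<infinity>)"

text \<open>Only the entries of a profile indexed by players are meaningful; the others are
  unconstrained and never used.\<close>

definition strategy_profile :: "nat \<Rightarrow> (nat \<Rightarrow> nat \<Rightarrow> nat) \<Rightarrow> bool" where
  "strategy_profile n S \<longleftrightarrow>
     (\<forall>v \<in> players n. \<forall>w \<in> players n. S v w \<in> {0, 1}) \<and> (\<forall>v \<in> players n. S v v = 0)"

definition final_graph :: "nat \<Rightarrow> (nat \<Rightarrow> nat \<Rightarrow> nat) \<Rightarrow> nat set set" where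
  "final_graph n S =
     {{v, w} |v w. v \<in> players n \<and> w \<in> players n \<and> v \<noteq> w \<and> (S v w = 1 \<or> S w v = 1)}"

definition anonymous :: "nat \<Rightarrow> (nat set set \<Rightarrow> nat set pmf) \<Rightarrow> bool" where
  "anonymous n Pr \<longleftrightarrow>
     (\<forall>S \<phi>. strategy_profile n S \<and> graph_automorphism n (final_graph n S) \<phi> \<longrightarrow>
        (\<forall>v \<in> players n. disconnection_cost n Pr (final_graph n S) v
                        = disconnection_cost n Pr (final_graph n S) (\<phi> v)))"

definition individual_cost ::
  "nat \<Rightarrow> real \<Rightarrow> (nat set set \<Rightarrow> nat set pmf) \<Rightarrow> (nat \<Rightarrow> nat \<Rightarrow> nat) \<Rightarrow> nat \<Rightarrow> ereal" where
  "individual_cost n \<alpha> Pr S v =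
     ereal (\<alpha> * real (\<Sum>w \<in> players n. S v w)) + disconnection_cost n Pr (final_graph n S) v"

definition nash_equilibrium ::
  "nat \<Rightarrow> real \<Rightarrow> (nat set set \<Rightarrow> nat set pmf) \<Rightarrow> (nat \<Rightarrow> nat \<Rightarrow> nat) \<Rightarrow> bool" where
  "nash_equilibrium n \<alpha> Pr S \<longleftrightarrow>
     strategy_profile n S \<and>
     (\<forall>v \<in> players n. \<forall>r. strategy_profile n (S(v := r)) \<longrightarrow>
        \<not> individual_cost n \<alpha> Pr (S(v := r)) v < individual_cost n \<alpha> Pr S v)"

text \<open>\<open>W\<close> is the set of the distinct players \<open>w\<^sub>1, \<dots>, w\<^sub>k\<close> to whom \<open>v\<close> additionally links.\<close>

definition maximal_nash_equilibrium ::
  "nat \<Rightarrow> real \<Rightarrow> (nat set set \<Rightarrow> nat set pmf) \<Rightarrow> (nat \<Rightarrow> nat \<Rightarrow> nat) \<Rightarrow> bool" where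
  "maximal_nash_equilibrium n \<alpha> Pr S \<longleftrightarrow>
     nash_equilibrium n \<alpha> Pr S \<and>
     (\<forall>v \<in> players n. \<forall>W. W \<noteq> {} \<and> W \<subseteq> players n - {v} \<and> (\<forall>w \<in> W. {v, w} \<notin> final_graph n S) \<longrightarrow>
        individual_cost n \<alpha> Pr S v
          < individual_cost n \<alpha> Pr (S(v := (\<lambda>w. if w \<in> W then 1 else S v w))) v)"

text \<open>The cyclic ordering is indexed by \<open>0, \<dots>, n - 1\<close> instead of \<open>1, \<dots>, n\<close>.\<close>

definition directed_cycle :: "nat \<Rightarrow> (nat \<Rightarrow> nat \<Rightarrow> nat) \<Rightarrow> bool" where
  "directed_cycle n S \<longleftrightarrow>
     (\<exists>c. bij_betw c {..<n} (players n) \<and>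
       (\<forall>v \<in> players n. \<forall>w \<in> players n.
          S v w = (if \<exists>i<n. v = c i \<and> w = c (Suc i mod n) then 1 else 0)))"

end

theory Submission imports Defs begin

text \<open>In the cycle nobody risks disconnection, so every player pays exactly \<open>\<alpha>\<close>; a deviator who
  still requests a link pays at least as much, and one who adds links pays at least \<open>2 * \<alpha>\<close>. The
  only other deviation drops the single requested link and turns the cycle into a path ending
  in the deviator, where every edge is relevant to her. Under anonymity both ends of the path
  suffer equally, and since the relevances of any edge for the two ends add up to \<open>n\<close>, each end
  has disconnection cost at least \<open>n / 2\<close>.\<close>

section \<open>Walks, cuts and relevance\<close>

lemma walk_singleton: "u \<in> players n \<Longrightarrow> walk n E u [u] u"
  by (simp add: walk_def walk_edges_def)

lemma walk_Cons:
  assumes "u \<in> players n" "{u, x} \<in> E" "walk n E x xs w"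
  shows "walk n E u (u # xs) w"
  using assms by (cases xs) (auto simp: walk_def walk_edges_def)

lemma walk_mono: "walk n E u xs w \<Longrightarrow> E \<subseteq> F \<Longrightarrow> walk n F u xs w"
  by (auto simp: walk_def)

text \<open>At the first step out of \<open>A\<close> the walk uses an edge between \<open>A\<close>
  and its complement, and by hypothesis this can only be \<open>e\<close>. The induction moves the
  start vertex along the walk for as long as it stays in \<open>A\<close>.\<close>

lemma walk_crosses_cut:
  assumes "walk n E u xs w" "u \<in> A" "w \<notin> A"
    and "\<And>x y. x \<in> A \<Longrightarrow> y \<in> players n - A \<Longrightarrow> {x, y} \<in> E \<Longrightarrow> {x, y} = e"
  shows "e \<in> set (walk_edges xs)"
  using assms(1,2)
proof (induction xs arbitrary: u)
  case Nil
  then show ?case by (simp add: walk_def)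
next
  case (Cons x ys)
  show ?case
  proof (cases ys)
    case Nil
    then show ?thesis using Cons.prems assms(3) by (auto simp: walk_def)
  next
    case (Cons y zs)
    have edge: "{u, y} \<in> E" "y \<in> players n" and x: "x = u" and tail: "walk n E y ys w"
      using Cons.prems Cons by (auto simp: walk_def walk_edges_def)
    have edges: "walk_edges (x # ys) = {u, y} # walk_edges ys"
      using Cons x by (simp add: walk_edges_def)
    show ?thesis
    proof (cases "y \<in> A")
      case True
      then show ?thesis using Cons.IH[OF tail] edges by simp
    next
      case False
      then show ?thesis using assms(4)[of u y] edge Cons.prems edges by auto
    qed
  qed
qed

text \<open>If only \<open>e\<close> can join the two sides of a cut, every walk from
  \<open>u\<close> to the far side passes through \<open>e\<close>. All lower bounds on relevance
  come from this.\<close>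

lemma card_le_relevance:
  assumes "u \<in> A" "B = players n - A"
    and "\<And>x y. x \<in> A \<Longrightarrow> y \<in> B \<Longrightarrow> {x, y} \<in> E \<Longrightarrow> {x, y} = e"
  shows "card B \<le> relevance n E e u"
  unfolding relevance_def
proof (rule card_mono)
  show "finite {w \<in> players n. \<forall>xs. walk n E u xs w \<longrightarrow> e \<in> set (walk_edges xs)}"
    by (simp add: players_def)
  show "B \<subseteq> {w \<in> players n. \<forall>xs. walk n E u xs w \<longrightarrow> e \<in> set (walk_edges xs)}"
    using assms walk_crosses_cut[of n E u _ _ A e] by auto
qed

section \<open>Costs and final graphs\<close>

lemma disconnection_cost_nonneg: "0 \<le> disconnection_cost n Pr E v"
  by (auto simp: disconnection_cost_def intro!: sum_nonneg)

text \<open>With disconnection cost nonnegative, possibly infinite, link cost alone is a lower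
  bound. It settles every deviation with enough links without a look at the resulting graph.\<close>

lemma link_cost_le_individual_cost:
  "ereal (\<alpha> * real (\<Sum>w\<in>players n. S v w)) \<le> individual_cost n \<alpha> Pr S v"
  unfolding individual_cost_def
  using add_left_mono[OF disconnection_cost_nonneg] by (metis add.right_neutral)

lemma simple_graph_final_graph: "simple_graph n (final_graph n S)"
  by (auto simp: simple_graph_def final_graph_def)

lemma final_graphI:
  "x \<in> players n \<Longrightarrow> y \<in> players n \<Longrightarrow> x \<noteq> y \<Longrightarrow> S x y = 1 \<Longrightarrow> {x, y} \<in> final_graph n S"
  unfolding final_graph_def by blast

lemma final_graphE:
  assumes "e \<in> final_graph n S"
  obtains x y where "e = {x, y}" "x \<in> players n" "y \<in> players n" "S x y = 1"
  using assms unfolding final_graph_def by (blast intro: insert_commute)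

lemma finite_final_graph: "finite (final_graph n S)"
proof -
  have "final_graph n S \<subseteq> Pow (players n)" by (auto simp: final_graph_def)
  then show ?thesis by (rule finite_subset) (simp add: players_def)
qed

text \<open>The measure is concentrated on the finitely many edges. Nonemptiness matters because
  \<open>adversary\<close> says nothing about the edgeless graph.\<close>

lemma adversary_sum_prob:
  assumes "adversary n Pr" "final_graph n S \<noteq> {}"
  shows "(\<Sum>e\<in>final_graph n S. measure_pmf.prob (Pr (final_graph n S)) {e}) = 1"
proof -
  have "set_pmf (Pr (final_graph n S)) \<subseteq> final_graph n S"
    using assms simple_graph_final_graph unfolding adversary_def by blast
  then show ?thesis
    using sum_pmf_eq_1[OF finite_final_graph] by (simp add: measure_pmf_single)
qed

section \<open>The path that remains when one link is dropped\<close>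

definition path_graph :: "nat \<Rightarrow> (nat \<Rightarrow> nat) \<Rightarrow> nat set set" where
  "path_graph n d = {{d k, d (Suc k)} |k. 1 \<le> k \<and> k < n}"

locale path_ordering =
  fixes n :: nat and d :: "nat \<Rightarrow> nat"
  assumes n_ge_3: "3 \<le> n" and bij: "bij_betw d {1..n} (players n)"
begin

lemma inj: "i \<in> {1..n} \<Longrightarrow> j \<in> {1..n} \<Longrightarrow> d i = d j \<longleftrightarrow> i = j"
  using bij by (meson bij_betw_inv_into_left bij_betw_imp_inj_on inj_on_eq_iff)

lemma in_players: "i \<in> {1..n} \<Longrightarrow> d i \<in> players n"
  using bij by (auto simp: bij_betw_def)

lemma players_cases:
  assumes "x \<in> players n" obtains i where "i \<in> {1..n}" "x = d i"
  using assms bij_betw_imp_surj_on[OF bij] by blast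

lemma edge_iff:
  assumes "i \<in> {1..n}" "j \<in> {1..n}"
  shows "{d i, d j} \<in> path_graph n d \<longleftrightarrow> j = Suc i \<or> i = Suc j"
proof
  assume "{d i, d j} \<in> path_graph n d"
  then obtain k where k: "1 \<le> k" "k < n" "{d i, d j} = {d k, d (Suc k)}"
    by (auto simp: path_graph_def)
  then have "k \<in> {1..n}" "Suc k \<in> {1..n}" by auto
  then show "j = Suc i \<or> i = Suc j"
    using k(3) inj assms by (metis doubleton_eq_iff)
next
  assume "j = Suc i \<or> i = Suc j"
  then show "{d i, d j} \<in> path_graph n d"
    using assms unfolding path_graph_def by fastforce
qed

lemma walk_up: "1 \<le> i \<Longrightarrow> i + k \<le> n \<Longrightarrow> \<exists>xs. walk n (path_graph n d) (d i) xs (d (i + k))"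
proof (induction k arbitrary: i)
  case 0
  then show ?case using walk_singleton in_players by force
next
  case (Suc k)
  then obtain xs where "walk n (path_graph n d) (d (Suc i)) xs (d (Suc i + k))" by fastforce
  then have "walk n (path_graph n d) (d i) (d i # xs) (d (Suc i + k))"
    using Suc.prems by (intro walk_Cons[of _ _ "d (Suc i)"]) (auto simp: edge_iff in_players)
  then show ?case by auto
qed

lemma walk_down: "1 \<le> i \<Longrightarrow> i + k \<le> n \<Longrightarrow> \<exists>xs. walk n (path_graph n d) (d (i + k)) xs (d i)"
proof (induction k)
  case 0
  then show ?case using walk_singleton in_players by force
next
  case (Suc k)
  then obtain xs where "walk n (path_graph n d) (d (i + k)) xs (d i)" by fastforce
  then have "walk n (path_graph n d) (d (i + Suc k)) (d (i + Suc k) # xs) (d i)"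
    using Suc.prems by (intro walk_Cons[of _ _ "d (i + k)"]) (auto simp: edge_iff in_players)
  then show ?case by auto
qed

lemma walk_exists:
  assumes "u \<in> players n" "w \<in> players n"
  shows "\<exists>xs. walk n (path_graph n d) u xs w"
proof -
  obtain i j where ij: "i \<in> {1..n}" "u = d i" "j \<in> {1..n}" "w = d j"
    using assms players_cases by metis
  then show ?thesis
    using walk_up[of i "j - i"] walk_down[of j "i - j"] by (cases "i \<le> j") auto
qed

text \<open>For \<open>n \<ge> 3\<close> the indices \<open>1\<close> and \<open>n\<close> are not
  consecutive, so walks in the path avoid the edge that closes the cycle. This later shows that the
  cycle has no bridge.\<close>

lemma closing_edge_notin_path: "{d n, d 1} \<notin> path_graph n d"
  using edge_iff[of n 1] n_ge_3 by auto

text \<open>Removing the edge separates the first \<open>k\<close> vertices from the last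
  \<open>n - k\<close>, and each end of the path loses the part on the other side. The two bounds
  add up to \<open>n\<close>.\<close>

lemma relevance_ends:
  assumes "1 \<le> k" "k < n"
  defines "e \<equiv> {d k, d (Suc k)}"
  shows "k \<le> relevance n (path_graph n d) e (d n)"
    and "n - k \<le> relevance n (path_graph n d) e (d 1)"
proof -
  let ?L = "d ` {1..k}" and ?R = "d ` {Suc k..n}"
  have inj_d: "inj_on d {1..n}" using bij by (simp add: bij_betw_def)
  have split: "{1..n} = {1..k} \<union> {Suc k..n}" "{1..k} \<inter> {Suc k..n} = {}"
    using assms by auto
  have "?L \<inter> ?R = {}"
    using split inj_on_image_Int[OF inj_d, of "{1..k}" "{Suc k..n}"] by auto
  moreover have "players n = ?L \<union> ?R"
    using bij split by (metis bij_betw_def image_Un)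
  ultimately have parts: "?L = players n - ?R" "?R = players n - ?L" by auto
  have "inj_on d {1..k}" "inj_on d {Suc k..n}"
    using split by (auto intro: inj_on_subset[OF inj_d])
  then have cards: "card ?L = k" "card ?R = n - k" by (auto simp: card_image)
  have cut: "{x, y} = e" if x: "x \<in> ?L" and y: "y \<in> ?R" and xy: "{x, y} \<in> path_graph n d"
    for x y
  proof -
    obtain i where i: "x = d i" "i \<in> {1..k}" using x by (rule imageE)
    obtain j where j: "y = d j" "j \<in> {Suc k..n}" using y by (rule imageE)
    have "j = Suc i \<or> i = Suc j"
      using i j xy assms by (subst edge_iff[symmetric]) auto
    \<comment> \<open>As \<open>i \<le> k < j\<close>, the indices can be consecutive only at the
      cut itself.\<close>
    then have "i = k \<and> j = Suc k" using i j by auto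
    then show ?thesis using i j by (simp add: e_def)
  qed
  have cut': "{x, y} = e" if "x \<in> ?R" "y \<in> ?L" "{x, y} \<in> path_graph n d" for x y
    using cut[of y x] that by (simp add: insert_commute)
  show "k \<le> relevance n (path_graph n d) e (d n)"
    using card_le_relevance[of "d n" ?R ?L, OF _ parts(1) cut'] assms cards by auto
  show "n - k \<le> relevance n (path_graph n d) e (d 1)"
    using card_le_relevance[of "d 1" ?L ?R, OF _ parts(2) cut] assms cards by auto
qed

text \<open>The witness sends \<open>d k\<close> to \<open>d (Suc n - k)\<close>; this reflection is
  its own inverse on indices and keeps consecutive indices consecutive.\<close>

lemma reversal_automorphism:
  obtains \<phi> where "graph_automorphism n (path_graph n d) \<phi>" "\<phi> (d n) = d 1"
proof
  define \<rho> where "\<rho> = (\<lambda>k. Suc n - k)"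
  define \<phi> where "\<phi> = d \<circ> \<rho> \<circ> inv_into {1..n} d"
  have \<rho>: "bij_betw \<rho> {1..n} {1..n}"
    by (rule bij_betw_byWitness[where f' = \<rho>]) (auto simp: \<rho>_def)
  have \<phi>_d: "\<phi> (d i) = d (\<rho> i)" if "i \<in> {1..n}" for i
    using that bij by (simp add: \<phi>_def bij_betw_inv_into_left)
  show "\<phi> (d n) = d 1" using \<phi>_d[of n] n_ge_3 by (simp add: \<rho>_def)
  have "bij_betw \<phi> (players n) (players n)"
    unfolding \<phi>_def comp_assoc
    by (rule bij_betw_trans[OF bij_betw_trans[OF bij_betw_inv_into[OF bij] \<rho>] bij])
  moreover have "{u, w} \<in> path_graph n d \<longleftrightarrow> {\<phi> u, \<phi> w} \<in> path_graph n d"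
    if u: "u \<in> players n" and w: "w \<in> players n" for u w
  proof -
    obtain i where i: "i \<in> {1..n}" "u = d i" using u by (rule players_cases)
    obtain j where j: "j \<in> {1..n}" "w = d j" using w by (rule players_cases)
    have "\<rho> i \<in> {1..n}" "\<rho> j \<in> {1..n}" using i j by (auto simp: \<rho>_def)
    then show ?thesis
      using i j by (auto simp: \<phi>_d edge_iff) (auto simp: \<rho>_def)
  qed
  ultimately show "graph_automorphism n (path_graph n d) \<phi>"
    by (simp add: graph_automorphism_def)
qed

lemma connected_path: "graph_connected n (path_graph n d)"
  using walk_exists by (simp add: graph_connected_def)

lemma path_nonempty: "path_graph n d \<noteq> {}"
  using n_ge_3 edge_iff[of 1 2] by auto

text \<open>The cost is a weighted mean of relevances, each at least 1 for the end
  \<open>d n\<close>. The matrix \<open>T\<close> presents the path as a final graph, the form in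
  which the edge probabilities are known to sum to 1.\<close>

lemma path_disconnection_cost_ge_1:
  assumes "adversary n Pr" "final_graph n T = path_graph n d"
  shows "1 \<le> disconnection_cost n Pr (path_graph n d) (d n)"
proof -
  let ?E = "path_graph n d"
  let ?p = "\<lambda>e. measure_pmf.prob (Pr ?E) {e}"
  have "1 = (\<Sum>e\<in>?E. ?p e)"
    using adversary_sum_prob[of n Pr T] assms path_nonempty by simp
  also have "\<dots> \<le> (\<Sum>e\<in>?E. real (relevance n ?E e (d n)) * ?p e)"
  proof (rule sum_mono)
    fix e assume "e \<in> ?E"
    then have "1 \<le> relevance n ?E e (d n)"
      using relevance_ends(1) le_trans unfolding path_graph_def by blast
    then show "?p e \<le> real (relevance n ?E e (d n)) * ?p e"
      using mult_right_mono[of 1 "real (relevance n ?E e (d n))" "?p e"] by simp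
  qed
  finally show ?thesis
    using connected_path by (simp add: disconnection_cost_def)
qed

text \<open>Reversal and anonymity give both ends the same cost. The weighted means of their
  relevances add up to at least \<open>n\<close>, so each is at least \<open>n / 2\<close>.\<close>

lemma path_disconnection_cost_anonymous:
  assumes "adversary n Pr" "final_graph n T = path_graph n d"
    and "strategy_profile n T" "anonymous n Pr"
  shows "ereal (n / 2) \<le> disconnection_cost n Pr (path_graph n d) (d n)"
proof -
  let ?E = "path_graph n d"
  let ?p = "\<lambda>e. measure_pmf.prob (Pr ?E) {e}"
  define I where "I u = (\<Sum>e\<in>?E. real (relevance n ?E e u) * ?p e)" for u
  have I: "disconnection_cost n Pr ?E u = ereal (I u)" for u
    using connected_path by (simp add: disconnection_cost_def I_def)
  obtain \<phi> where "graph_automorphism n ?E \<phi>" "\<phi> (d n) = d 1"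
    by (rule reversal_automorphism)
  \<comment> \<open>Anonymity speaks only of final graphs of strategy profiles; \<open>T\<close>
    supplies one.\<close>
  then have "disconnection_cost n Pr ?E (d n) = disconnection_cost n Pr ?E (d 1)"
    using assms in_players[of n] n_ge_3 unfolding anonymous_def
    by (metis atLeastAtMost_iff le_trans one_le_numeral order_refl)
  then have eq: "I (d n) = I (d 1)" by (simp add: I)
  have "real n = real n * (\<Sum>e\<in>?E. ?p e)"
    using adversary_sum_prob[of n Pr T] assms path_nonempty by simp
  also have "\<dots> = (\<Sum>e\<in>?E. real n * ?p e)" by (rule sum_distrib_left)
  also have "\<dots> \<le> (\<Sum>e\<in>?E. real (relevance n ?E e (d n) + relevance n ?E e (d 1)) * ?p e)"
  proof (intro sum_mono mult_right_mono)
    fix e assume "e \<in> ?E"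
    then obtain k where k: "1 \<le> k" "k < n" "e = {d k, d (Suc k)}"
      by (auto simp: path_graph_def)
    show "real n \<le> real (relevance n ?E e (d n) + relevance n ?E e (d 1))"
      unfolding of_nat_le_iff k(3) using relevance_ends[OF k(1,2)] by linarith
  qed simp
  also have "\<dots> = I (d n) + I (d 1)"
    by (simp add: I_def sum.distrib distrib_right)
  finally show ?thesis using eq by (simp add: I)
qed

end

section \<open>The directed cycle seen from one player\<close>

text \<open>The numbering follows the links and ends with a distinguished player \<open>d n\<close>,
  whose only link closes the cycle. The two cases of \<open>S_eq\<close> separate this link from
  those along the path.\<close>

locale cycle_ordering = path_ordering n d for n d +
  fixes S :: "nat \<Rightarrow> nat \<Rightarrow> nat"
  assumes S_eq: "x \<in> players n \<Longrightarrow> y \<in> players n \<Longrightarrow>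
    S x y = (if (x = d n \<and> y = d 1) \<or> (\<exists>k. 1 \<le> k \<and> k < n \<and> x = d k \<and> y = d (Suc k)) then 1 else 0)"
begin

lemma link_cases:
  assumes "S x y = 1" "x \<in> players n" "y \<in> players n"
  obtains "x = d n" "y = d 1" | k where "1 \<le> k" "k < n" "x = d k" "y = d (Suc k)"
  using assms S_eq[of x y] by (metis zero_neq_one)

lemma final_graph_cycle: "final_graph n S = insert {d n, d 1} (path_graph n d)"
proof
  show "final_graph n S \<subseteq> insert {d n, d 1} (path_graph n d)"
  proof
    fix e assume "e \<in> final_graph n S"
    then obtain x y where "e = {x, y}" "x \<in> players n" "y \<in> players n" "S x y = 1"
      by (rule final_graphE)
    then show "e \<in> insert {d n, d 1} (path_graph n d)"
      using link_cases unfolding path_graph_def by blast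
  qed
  have "{d n, d 1} \<in> final_graph n S"
    using n_ge_3 by (intro final_graphI) (auto simp: in_players inj S_eq)
  moreover have "{d k, d (Suc k)} \<in> final_graph n S" if "1 \<le> k" "k < n" for k
    using that by (intro final_graphI) (auto simp: in_players inj S_eq)
  ultimately show "insert {d n, d 1} (path_graph n d) \<subseteq> final_graph n S"
    by (auto simp: path_graph_def)
qed

text \<open>The path edges are requested by \<open>d k\<close> with \<open>k < n\<close>, whose rows
  are unchanged, while the closing edge was requested by \<open>d n\<close> alone.\<close>

lemma final_graph_drop_link:
  assumes "\<And>w. w \<in> players n \<Longrightarrow> r w = 0"
  shows "final_graph n (S(d n := r)) = path_graph n d"
proof
  show "final_graph n (S(d n := r)) \<subseteq> path_graph n d"
  proof
    fix e assume "e \<in> final_graph n (S(d n := r))"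
    then obtain x y where e: "e = {x, y}" "x \<in> players n" "y \<in> players n"
      and "(S(d n := r)) x y = 1"
      by (rule final_graphE)
    then have "x \<noteq> d n" "S x y = 1" using assms by (auto split: if_splits)
    then show "e \<in> path_graph n d"
      using e link_cases unfolding path_graph_def by blast
  qed
  have "{d k, d (Suc k)} \<in> final_graph n (S(d n := r))" if "1 \<le> k" "k < n" for k
    using that by (intro final_graphI) (auto simp: in_players inj S_eq)
  then show "path_graph n d \<subseteq> final_graph n (S(d n := r))"
    by (auto simp: path_graph_def)
qed

lemma row_sum: "(\<Sum>w\<in>players n. S (d n) w) = 1"
proof -
  have "S (d n) w = (if w = d 1 then 1 else 0)" if "w \<in> players n" for w
    using that S_eq[of "d n" w] in_players[of n] n_ge_3 inj[of n] by fastforce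
  then show ?thesis
    using in_players[of 1] n_ge_3 by (simp add: players_def)
qed

end

lemma (in path_ordering) cycle_orderingI:
  assumes "\<And>x y. x \<in> players n \<Longrightarrow> y \<in> players n \<Longrightarrow>
      S x y = (if \<exists>k\<in>{1..n}. x = d k \<and> y = d (Suc k) then 1 else 0)"
    and "d (Suc n) = d 1"
  shows "cycle_ordering n d S"
proof
  fix x y assume "x \<in> players n" "y \<in> players n"
  moreover have "(\<exists>k\<in>{1..n}. x = d k \<and> y = d (Suc k)) \<longleftrightarrow>
      (x = d n \<and> y = d 1) \<or> (\<exists>k. 1 \<le> k \<and> k < n \<and> x = d k \<and> y = d (Suc k))"
    \<comment> \<open>The index \<open>k = n\<close> yields the closing link, since
      \<open>d (Suc n) = d 1\<close>.\<close>
    using n_ge_3 assms(2) by (auto simp: le_less)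
  ultimately show "S x y =
      (if (x = d n \<and> y = d 1) \<or> (\<exists>k. 1 \<le> k \<and> k < n \<and> x = d k \<and> y = d (Suc k)) then 1 else 0)"
    using assms(1) by simp
qed

lemma bij_betw_add_mod:
  fixes i n :: nat
  assumes "0 < n"
  shows "bij_betw (\<lambda>k. (i + k) mod n) {1..n} {..<n}"
proof -
  have "inj_on (\<lambda>k. (i + k) mod n) {1..n}"
  proof (rule linorder_inj_onI)
    fix a b assume ab: "a < b" "a \<in> {1..n}" "b \<in> {1..n}"
    show "(i + a) mod n \<noteq> (i + b) mod n"
    proof
      assume "(i + a) mod n = (i + b) mod n"
      \<comment> \<open>A common residue would make \<open>b - a\<close> a multiple of
        \<open>n\<close>, although \<open>0 < b - a < n\<close>.\<close>
      then have "n dvd (i + b) - (i + a)"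
        using ab by (metis mod_eq_dvd_iff_nat add_le_cancel_left less_imp_le)
      then show False using ab by (auto dest: dvd_imp_le)
    qed
  qed auto
  moreover from this have "(\<lambda>k. (i + k) mod n) ` {1..n} = {..<n}"
    using assms by (intro card_subset_eq) (auto simp: card_image)
  ultimately show ?thesis by (simp add: bij_betw_def)
qed

text \<open>Rotational symmetry: the numbering can be turned so that any given player comes last. It
  therefore suffices to study the closing link.\<close>

lemma directed_cycle_orderingE:
  assumes "directed_cycle n S" "3 \<le> n" "v \<in> players n"
  obtains d where "cycle_ordering n d S" "d n = v"
proof -
  obtain c where c: "bij_betw c {..<n} (players n)"
    and S: "\<And>x y. x \<in> players n \<Longrightarrow> y \<in> players n \<Longrightarrow>
      S x y = (if \<exists>j<n. x = c j \<and> y = c (Suc j mod n) then 1 else 0)"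
    using assms(1) unfolding directed_cycle_def by blast
  obtain i where i: "i < n" "v = c i"
    using c assms(3) by (auto simp: bij_betw_def)
  \<comment> \<open>Since \<open>v = c i\<close>, the shift by \<open>i\<close> gives
    \<open>d n = v\<close>; reduction modulo \<open>n\<close> makes \<open>d (Suc n)\<close> return
    to \<open>d 1\<close>.\<close>
  define d where "d k = c ((i + k) mod n)" for k
  have shift: "bij_betw (\<lambda>k. (i + k) mod n) {1..n} {..<n}"
    using assms(2) by (intro bij_betw_add_mod) simp
  have "bij_betw d {1..n} (players n)"
    using bij_betw_trans[OF shift c] unfolding d_def comp_def .
  then interpret path_ordering n d
    using assms(2) by unfold_locales
  have "(\<exists>j<n. x = c j \<and> y = c (Suc j mod n)) \<longleftrightarrow> (\<exists>k\<in>{1..n}. x = d k \<and> y = d (Suc k))" for x y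
  proof -
    have "(\<exists>j<n. x = c j \<and> y = c (Suc j mod n)) \<longleftrightarrow>
        (\<exists>j\<in>(\<lambda>k. (i + k) mod n) ` {1..n}. x = c j \<and> y = c (Suc j mod n))"
      using shift by (auto simp: bij_betw_def)
    also have "\<dots> \<longleftrightarrow> (\<exists>k\<in>{1..n}. x = d k \<and> y = d (Suc k))"
      by (simp add: d_def mod_Suc_eq)
    finally show ?thesis .
  qed
  moreover have "d (Suc n) = d 1"
  proof -
    have "i + Suc n = i + 1 + n" by simp
    then show ?thesis by (simp only: d_def mod_add_self2)
  qed
  ultimately have "cycle_ordering n d S"
    using S by (intro cycle_orderingI) auto
  moreover have "d n = v" using i by (simp add: d_def)
  ultimately show ?thesis using that by blast
qed

lemma directed_cycle_strategy_profile:
  assumes "directed_cycle n S" "3 \<le> n"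
  shows "strategy_profile n S"
  unfolding strategy_profile_def
proof (intro conjI ballI)
  fix v assume v: "v \<in> players n"
  then obtain d where d: "cycle_ordering n d S" "d n = v"
    using directed_cycle_orderingE assms by blast
  then interpret cycle_ordering n d S by simp
  show "S v v = 0"
    using S_eq[OF v v] d(2) inj[of n 1] inj[of n] n_ge_3 by fastforce
  show "S v w \<in> {0, 1}" if "w \<in> players n" for w
    using S_eq[OF v that] by simp
qed

text \<open>Every edge is the closing edge of the numbering that ends with its requester. The
  remaining path still joins all players, so no edge is a bridge.\<close>

lemma directed_cycle_disconnection_cost:
  assumes "directed_cycle n S" "3 \<le> n" "v \<in> players n"
  shows "disconnection_cost n Pr (final_graph n S) v = 0"
proof -
  let ?E = "final_graph n S"
  obtain d where d: "cycle_ordering n d S"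
    using directed_cycle_orderingE assms by blast
  interpret cycle_ordering n d S by (rule d)
  have conn: "graph_connected n ?E"
    using walk_exists walk_mono[of n "path_graph n d" _ _ _ ?E] final_graph_cycle
    unfolding graph_connected_def by blast
  have "relevance n ?E e v = 0" if e: "e \<in> ?E" for e
  proof -
    obtain x y where xy: "e = {x, y}" "x \<in> players n" "y \<in> players n" "S x y = 1"
      using e by (rule final_graphE)
    obtain d' where d': "cycle_ordering n d' S" "d' n = x"
      using directed_cycle_orderingE assms xy by blast
    interpret D: cycle_ordering n d' S by (rule d')
    \<comment> \<open>The other case of \<open>link_cases\<close> would give
      \<open>d' n = d' k\<close> with \<open>k < n\<close>.\<close>
    have "y = d' 1"
      using xy(4,2,3)
    proof (cases rule: D.link_cases)
      case (2 k)
      then show ?thesis using d'(2) D.inj[of n k] by simp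
    qed
    then have e_eq: "e = {d' n, d' 1}" using xy d' by simp
    have "\<exists>xs. walk n ?E v xs w \<and> e \<notin> set (walk_edges xs)" if w: "w \<in> players n" for w
    proof -
      obtain xs where xs: "walk n (path_graph n d') v xs w"
        using D.walk_exists[OF assms(3) w] by blast
      then have "e \<notin> set (walk_edges xs)"
        using D.closing_edge_notin_path e_eq by (auto simp: walk_def)
      then show ?thesis
        using walk_mono[OF xs] D.final_graph_cycle by blast
    qed
    then have "{w \<in> players n. \<forall>xs. walk n ?E v xs w \<longrightarrow> e \<in> set (walk_edges xs)} = {}"
      by blast
    then show ?thesis unfolding relevance_def by (simp only: card.empty)
  qed
  then show ?thesis using conn by (simp add: disconnection_cost_def)
qed

section \<open>Deviations and additional links\<close>

text \<open>Both claims are treated together: they differ only in the lower bound, 1 or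
  \<open>n / 2\<close>, for the disconnection cost after dropping the link.\<close>

lemma directed_cycle_maximal_nash:
  assumes "3 \<le> n" "0 < \<alpha>" "adversary n Pr" "directed_cycle n S"
    and "\<alpha> \<le> 1 \<or> (\<alpha> \<le> n / 2 \<and> anonymous n Pr)"
  shows "maximal_nash_equilibrium n \<alpha> Pr S"
proof -
  have cost: "individual_cost n \<alpha> Pr S v = ereal \<alpha>" if v: "v \<in> players n" for v
  proof -
    obtain d where d: "cycle_ordering n d S" "d n = v"
      using directed_cycle_orderingE assms v by blast
    then interpret cycle_ordering n d S by simp
    show ?thesis
      using row_sum d(2) directed_cycle_disconnection_cost[OF assms(4,1) v]
      by (simp add: individual_cost_def flip: of_nat_sum)
  qed
  have "\<not> individual_cost n \<alpha> Pr (S(v := r)) v < ereal \<alpha>"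
    if v: "v \<in> players n" and r: "strategy_profile n (S(v := r))" for v r
  proof (cases "\<forall>w\<in>players n. r w = 0")
    case True
    obtain d where d: "cycle_ordering n d S" "d n = v"
      using directed_cycle_orderingE assms v by blast
    then interpret cycle_ordering n d S by simp
    have G: "final_graph n (S(v := r)) = path_graph n d"
      using final_graph_drop_link[of r] True d(2) by simp
    have "ereal \<alpha> \<le> disconnection_cost n Pr (path_graph n d) v"
      using assms(5)
    proof
      assume "\<alpha> \<le> 1"
      then have "ereal \<alpha> \<le> 1" by simp
      then show ?thesis
        using path_disconnection_cost_ge_1[OF assms(3) G] d(2) order_trans by blast
    next
      assume "\<alpha> \<le> n / 2 \<and> anonymous n Pr"
      moreover from this have "ereal \<alpha> \<le> ereal (n / 2)" by simp
      ultimately show ?thesis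
        using path_disconnection_cost_anonymous[OF assms(3) G r] d(2) order_trans by blast
    qed
    then show ?thesis using True G by (simp add: individual_cost_def not_less flip: zero_ereal_def)
  next
    case False
    \<comment> \<open>One requested link already costs \<open>\<alpha>\<close>, whatever graph
      results.\<close>
    then obtain w where "w \<in> players n" "1 \<le> r w" by fastforce
    then have "1 \<le> (\<Sum>w\<in>players n. (S(v := r)) v w)"
      using member_le_sum[of w "players n" r] by (fastforce simp: players_def)
    then have "\<alpha> * 1 \<le> \<alpha> * real (\<Sum>w\<in>players n. (S(v := r)) v w)"
      using assms(2) by (intro mult_left_mono) linarith+
    then have "ereal \<alpha> \<le> ereal (\<alpha> * real (\<Sum>w\<in>players n. (S(v := r)) v w))" by simp
    then show ?thesis
      using link_cost_le_individual_cost order_trans not_less by blast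
  qed
  then have nash: "nash_equilibrium n \<alpha> Pr S"
    using directed_cycle_strategy_profile[OF assms(4,1)] cost by (simp add: nash_equilibrium_def)
  have "ereal \<alpha> < individual_cost n \<alpha> Pr (S(v := (\<lambda>w. if w \<in> W then 1 else S v w))) v"
    if v: "v \<in> players n" and "W \<noteq> {}" and W: "W \<subseteq> players n - {v}"
      and new: "\<forall>w \<in> W. {v, w} \<notin> final_graph n S" for v W
  proof -
    let ?T = "S(v := (\<lambda>w. if w \<in> W then 1 else S v w))"
    obtain d where d: "cycle_ordering n d S" "d n = v"
      using directed_cycle_orderingE assms v by blast
    then interpret cycle_ordering n d S by simp
    obtain w where w: "w \<in> W" using \<open>W \<noteq> {}\<close> by blast
    \<comment> \<open>As \<open>{v, d 1}\<close> is an edge already, \<open>d 1\<close> lies outside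
      \<open>W\<close>. The old link and a new one are thus distinct and cost
      \<open>2 * \<alpha>\<close>, which exceeds \<open>\<alpha>\<close>.\<close>
    have w1: "w \<noteq> d 1" using new w d(2) final_graph_cycle by auto
    have d1: "d 1 \<in> players n" using in_players[of 1] n_ge_3 by simp
    have "2 \<le> ?T v w + ?T v (d 1)"
      using w S_eq[OF v d1] d(2) by simp
    also have "\<dots> = (\<Sum>x\<in>{w, d 1}. ?T v x)" using w1 by simp
    also have "\<dots> \<le> (\<Sum>x\<in>players n. ?T v x)"
      using w W d1 by (intro sum_mono2) (auto simp: players_def)
    finally have "\<alpha> * 2 \<le> \<alpha> * real (\<Sum>x\<in>players n. ?T v x)"
      using assms(2) by (intro mult_left_mono) linarith+
    then have "ereal \<alpha> < ereal (\<alpha> * real (\<Sum>x\<in>players n. ?T v x))"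
      using assms(2) by (simp only: less_ereal.simps)
    then show ?thesis
      using link_cost_le_individual_cost less_le_trans by blast
  qed
  then show ?thesis
    using nash cost by (simp add: maximal_nash_equilibrium_def)
qed

theorem proposition7p4:
  fixes n :: nat and \<alpha> :: real
    and Pr :: "nat set set \<Rightarrow> nat set pmf"
    and S :: "nat \<Rightarrow> nat \<Rightarrow> nat"
  assumes "n \<ge> 3" and "\<alpha> > 0"
    and "adversary n Pr"
    and "directed_cycle n S"
  shows "(\<alpha> \<le> 1 \<longrightarrow> maximal_nash_equilibrium n \<alpha> Pr S) \<and>
         (\<alpha> \<le> 1 / 2 * real_of_int \<lfloor>(real n - 1) / 2\<rfloor> \<and> anonymous n Pr \<longrightarrow>
            maximal_nash_equilibrium n \<alpha> Pr S)"
proof -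
  \<comment> \<open>The left side is at most \<open>(n - 1) / 4\<close>, so the bound
    \<open>n / 2\<close> leaves ample room.\<close>
  have "1 / 2 * real_of_int \<lfloor>(real n - 1) / 2\<rfloor> \<le> n / 2"
    using of_int_floor_le[of "(real n - 1) / 2"] of_nat_0_le_iff[of n] by simp
  then show ?thesis
    using directed_cycle_maximal_nash[OF assms] by linarith
qed

end
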